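(* Let $k\in(0,1)$, let $n\ge3$, and let $C_1$ be a circle of positive radius inside the unit circle $T$ belonging to the coaxal pencil $\{C_a : a\in(-K,K]\}$ determined by $T$ and the limit point $L=\frac{k'-1}{k'+1}$, $k'=\sqrt{1-k^2}$. Then an interscribed $n$-gon to $T$ and $C_1$ exists if and only if $C_1$ is an element of order $n$ in the group $A_k$ (that is, writing $C_1=C_a$ with $a=g(\alpha;k)$, the element $\psi_\alpha$ has order $n$ in $A_k$). Furthermore, if such a polygon exists, then each of its diagonals is tangent to a circle of the pencil.
   Context: $T$ is the unit circle in $\mathbb C=\mathbb R^2$. Let $g(\theta)=g(\theta;k)=\int_0^\theta \frac{dt}{\sqrt{1-k^2\sin^2 t}}$ for $\theta\in\mathbb R$, $K=g(\pi/2)$, $\mathrm{am}=g^{-1}:\mathbb R\to\mathbb R$, $\mathrm{sn}\,u=\sin(\mathrm{am}\,u)$, $\mathrm{cn}\,u=\cos(\mathrm{am}\,u)$, $\mathrm{dn}\,u=\sqrt{1-k^2\,\mathrm{sn}^2u}$. For $a\in(-K,K]$, $C_a$ is the circle with center $\left(\frac{\mathrm{dn}\,a-1}{\mathrm{dn}\,a+1},0\right)$ and radius $\frac{2\,\mathrm{cn}\,a}{1+\mathrm{dn}\,a}$ (positively oriented if $0<a<K$, negatively oriented if $-K<a<0$); $C_0=T$ and $C_K$ is the point circle $L$. These are the circles, interior to or equal to $T$, of the coaxal pencil determined by $T$ and $L$. A line is tangent to the point circle $L$ if it passes through $L$. The map $\psi_\alpha:T\to T$, $\alpha\in\mathbb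 R$: for $z=e^{2i\theta}\in T$ ($\theta\in\mathbb R$), put $u=g(\theta)$, $a=g(\alpha)$, $\theta'=\mathrm{am}(u+a)$, and $\psi_\alpha(z)=e^{2i\theta'}$ (independent of the choice of $\theta$). $A_k=\{\psi_\alpha:\alpha\in(-\frac12\pi,\frac12\pi]\}$ is a commutative group under composition. The oriented circle $C_a$ is identified with $\psi_\alpha\in A_k$, where $a=g(\alpha)$; equivalently, $C_a$ corresponds to $a$ in the group $(-K,K]$ under addition modulo $2K$. The order of $C_a$ does not depend on its orientation, i.e. on the choice of the sign of $a$. An interscribed $n$-gon to $T$ and $C_1$ is a polygon with $n$ distinct vertices on the outer circle $T$ (possibly self-intersecting) all of whose $n$ sides are tangent to the inner circle $C_1$. A diagonal is a segment joining two non-consecutive vertices. *)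

theory Defs
  imports "HOL-Analysis.Analysis" "HOL-Algebra.Multiplicative_Group" "HOL-Algebra.Bij"
begin

section \<open>Jacobi elliptic functions\<close>

text \<open>The modulus \<open>k\<close> is the first argument throughout. The interval integral is oriented,
  so \<open>ell_g k\<close> is odd.\<close>

definition ell_g :: "real \<Rightarrow> real \<Rightarrow> real" where
  "ell_g k \<theta> = (LBINT t=ereal 0..ereal \<theta>. 1 / sqrt (1 - k\<^sup>2 * (sin t)\<^sup>2))"

definition ell_K :: "real \<Rightarrow> real" where
  "ell_K k = ell_g k (pi / 2)"

definition am :: "real \<Rightarrow> real \<Rightarrow> real" where
  "am k = inv_into UNIV (ell_g k)"

definition sn :: "real \<Rightarrow> real \<Rightarrow> real" where
  "sn k u = sin (am k u)"

definition cn :: "real \<Rightarrow> real \<Rightarrow> real" where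
  "cn k u = cos (am k u)"

definition dn :: "real \<Rightarrow> real \<Rightarrow> real" where
  "dn k u = sqrt (1 - k\<^sup>2 * (sn k u)\<^sup>2)"

section \<open>The pencil of circles\<close>

abbreviation unit_circle :: "complex set" where
  "unit_circle \<equiv> sphere 0 1"

definition pencil_center :: "real \<Rightarrow> real \<Rightarrow> complex" where
  "pencil_center k a = complex_of_real ((dn k a - 1) / (dn k a + 1))"

definition pencil_radius :: "real \<Rightarrow> real \<Rightarrow> real" where
  "pencil_radius k a = 2 * cn k a / (1 + dn k a)"

text \<open>The point set of \<open>C\<^sub>a\<close>; orientation is recorded only by the parameter \<open>a\<close>.
  For \<open>a = ell_K k\<close> the radius is \<open>0\<close> and the sphere is the singleton of the limit point
  \<open>L = (k' - 1) / (k' + 1)\<close>, \<open>k' = sqrt (1 - k\<^sup>2)\<close>.\<close>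

definition pencil_circle :: "real \<Rightarrow> real \<Rightarrow> complex set" where
  "pencil_circle k a = sphere (pencil_center k a) (pencil_radius k a)"

definition pencil :: "real \<Rightarrow> complex set set" where
  "pencil k = pencil_circle k ` {- ell_K k<..ell_K k}"

section \<open>The group of circle maps\<close>

text \<open>The value does not depend on the choice of \<open>\<theta>\<close>; see \<open>psi_cis\<close> below.\<close>

definition psi :: "real \<Rightarrow> real \<Rightarrow> complex \<Rightarrow> complex" where
  "psi k \<alpha> = (\<lambda>z\<in>unit_circle.
     let \<theta> = (SOME \<theta>. z = cis (2 * \<theta>)) in cis (2 * am k (ell_g k \<theta> + ell_g k \<alpha>)))"

definition circle_group :: "real \<Rightarrow> (complex \<Rightarrow> complex) monoid" where
  "circle_group k = (BijGroup unit_circle)\<lparr>carrier := psi k ` {- pi / 2<..pi / 2}\<rparr>"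

section \<open>Interscribed polygons\<close>

text \<open>The line through \<open>p\<close> and \<open>q\<close> is tangent to the circle \<open>C\<close>, i.e. meets it in exactly one
  point. If \<open>C\<close> is a point circle (a singleton), this says that the line passes through it.\<close>

definition line_tangent :: "complex \<Rightarrow> complex \<Rightarrow> complex set \<Rightarrow> bool" where
  "line_tangent p q C \<longleftrightarrow> p \<noteq> q \<and> (\<exists>!x. x \<in> affine hull {p, q} \<inter> C)"

text \<open>The vertices of an \<open>n\<close>-gon are \<open>v 0, \<dots>, v (n - 1)\<close> in cyclic order.\<close>

definition interscribed :: "nat \<Rightarrow> (nat \<Rightarrow> complex) \<Rightarrow> complex set \<Rightarrow> bool" where
  "interscribed n v C \<longleftrightarrow>
     inj_on v {..<n} \<and> v ` {..<n} \<subseteq> unit_circle \<and>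
     (\<forall>i<n. line_tangent (v i) (v (Suc i mod n)) C)"

definition consecutive :: "nat \<Rightarrow> nat \<Rightarrow> nat \<Rightarrow> bool" where
  "consecutive n i j \<longleftrightarrow> j = Suc i mod n \<or> i = Suc j mod n"

section \<open>Well-definedness of the circle maps and their group\<close>

lemma modulus_pos: "0 < 1 - k\<^sup>2 * (sin t)\<^sup>2" if "\<bar>k\<bar> < 1" for k t :: real
proof -
  have "k\<^sup>2 < 1" using that by (simp add: abs_square_less_1)
  moreover have "(sin t)\<^sup>2 \<le> 1" by (simp add: abs_square_le_1)
  ultimately have "k\<^sup>2 * (sin t)\<^sup>2 < 1"
    by (metis mult_le_one mult_left_le le_less_trans zero_le_power2)
  then show ?thesis by simp
qed

lemma ell_g_deriv:
  assumes "\<bar>k\<bar> < 1"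
  shows "(ell_g k has_real_derivative 1 / sqrt (1 - k\<^sup>2 * (sin x)\<^sup>2)) (at x)"
proof -
  let ?f = "\<lambda>t. 1 / sqrt (1 - k\<^sup>2 * (sin t)\<^sup>2)"
  define M where "M = \<bar>x\<bar> + 1"
  have cont: "continuous_on {-M..M} ?f"
    using modulus_pos[OF assms] by (intro continuous_intros) (auto simp: less_imp_neq[symmetric])
  have "((\<lambda>u. LBINT y=ereal 0..ereal u. ?f y) has_vector_derivative ?f x) (at x within {-M..M})"
    by (rule interval_integral_FTC2[OF _ _ cont]) (auto simp: M_def)
  moreover have "at x within {-M..M} = at x"
    by (rule at_within_Icc_at) (auto simp: M_def)
  ultimately show ?thesis
    by (simp add: has_real_derivative_iff_has_vector_derivative ell_g_def[abs_def])
qed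

lemma ell_g_0 [simp]: "ell_g k 0 = 0"
  by (simp add: ell_g_def zero_ereal_def)

lemma ell_g_expand:
  assumes "\<bar>k\<bar> < 1" "x \<le> y"
  shows "y - x \<le> ell_g k y - ell_g k x"
proof -
  have "ell_g k x - x \<le> ell_g k y - y"
  proof (rule DERIV_nonneg_imp_nondecreasing[OF assms(2)])
    fix t
    have "sqrt (1 - k\<^sup>2 * (sin t)\<^sup>2) \<le> 1" by simp
    then have "0 \<le> 1 / sqrt (1 - k\<^sup>2 * (sin t)\<^sup>2) - 1"
      using modulus_pos[OF assms(1), of t] by (simp add: field_simps)
    moreover have "((\<lambda>t. ell_g k t - t) has_real_derivative 1 / sqrt (1 - k\<^sup>2 * (sin t)\<^sup>2) - 1) (at t)"
      by (intro derivative_intros ell_g_deriv assms)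
    ultimately show "\<exists>d. ((\<lambda>t. ell_g k t - t) has_real_derivative d) (at t) \<and> 0 \<le> d" by blast
  qed
  then show ?thesis by simp
qed

lemma bij_ell_g:
  assumes "\<bar>k\<bar> < 1"
  shows "bij (ell_g k)"
proof (rule bijI)
  show "inj (ell_g k)"
  proof (rule linorder_injI)
    fix x y :: real assume "x < y"
    then show "ell_g k x \<noteq> ell_g k y" using ell_g_expand[OF assms, of x y] by simp
  qed
  show "surj (ell_g k)"
  proof (unfold surj_def, intro allI)
    fix u
    have "ell_g k (- \<bar>u\<bar>) \<le> u" "u \<le> ell_g k \<bar>u\<bar>"
      using ell_g_expand[OF assms, of "-\<bar>u\<bar>" 0] ell_g_expand[OF assms, of 0 "\<bar>u\<bar>"] by auto
    then show "\<exists>x. u = ell_g k x"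
      using IVT[of "ell_g k" "- \<bar>u\<bar>" u "\<bar>u\<bar>"] ell_g_deriv[OF assms] DERIV_isCont by fastforce
  qed
qed

lemma am_ell_g [simp]: "\<bar>k\<bar> < 1 \<Longrightarrow> am k (ell_g k \<theta>) = \<theta>"
  unfolding am_def using bij_ell_g by (simp add: bij_is_inj)

lemma ell_g_am [simp]: "\<bar>k\<bar> < 1 \<Longrightarrow> ell_g k (am k u) = u"
  unfolding am_def using bij_ell_g by (simp add: bij_is_surj surj_f_inv_f)

lemma DERIV_zero_eq:
  fixes f :: "real \<Rightarrow> real"
  assumes "\<And>x. (f has_real_derivative 0) (at x)"
  shows "f x = f y"
  using DERIV_isconst_all assms by blast

lemma ell_g_minus:
  assumes "\<bar>k\<bar> < 1"
  shows "ell_g k (- \<theta>) = - ell_g k \<theta>"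
proof -
  have "ell_g k (- \<theta>) + ell_g k \<theta> = ell_g k (- 0) + ell_g k 0"
  proof (rule DERIV_zero_eq[of "\<lambda>\<theta>. ell_g k (- \<theta>) + ell_g k \<theta>"])
    fix x
    have "((\<lambda>\<theta>. ell_g k (- \<theta>) + ell_g k \<theta>) has_real_derivative
        1 / sqrt (1 - k\<^sup>2 * (sin (- x))\<^sup>2) * (- 1) + 1 / sqrt (1 - k\<^sup>2 * (sin x)\<^sup>2)) (at x)"
      by (intro DERIV_add DERIV_chain2[OF ell_g_deriv[OF assms]] ell_g_deriv[OF assms])
        (auto intro!: derivative_eq_intros)
    then show "((\<lambda>\<theta>. ell_g k (- \<theta>) + ell_g k \<theta>) has_real_derivative 0) (at x)"
      by simp
  qed
  then show ?thesis by simp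
qed

lemma ell_g_add_pi:
  assumes "\<bar>k\<bar> < 1"
  shows "ell_g k (\<theta> + pi) = ell_g k \<theta> + 2 * ell_K k"
proof -
  have "ell_g k (\<theta> + pi) - ell_g k \<theta> = ell_g k (- pi / 2 + pi) - ell_g k (- pi / 2)"
  proof (rule DERIV_zero_eq[of "\<lambda>\<theta>. ell_g k (\<theta> + pi) - ell_g k \<theta>"])
    fix x
    have "((\<lambda>\<theta>. ell_g k (\<theta> + pi) - ell_g k \<theta>) has_real_derivative
        1 / sqrt (1 - k\<^sup>2 * (sin (x + pi))\<^sup>2) * 1 - 1 / sqrt (1 - k\<^sup>2 * (sin x)\<^sup>2)) (at x)"
      by (intro DERIV_diff DERIV_chain2[OF ell_g_deriv[OF assms]] ell_g_deriv[OF assms])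
        (auto intro!: derivative_eq_intros)
    then show "((\<lambda>\<theta>. ell_g k (\<theta> + pi) - ell_g k \<theta>) has_real_derivative 0) (at x)"
      by simp
  qed
  moreover have "- pi / 2 + pi = pi / 2" by simp
  moreover have "ell_g k (- pi / 2) = - ell_K k"
    using ell_g_minus[OF assms, of "pi / 2"] by (simp add: ell_K_def)
  ultimately show ?thesis by (simp add: ell_K_def)
qed

lemma ell_g_add_npi:
  assumes "\<bar>k\<bar> < 1"
  shows "ell_g k (\<theta> + of_int m * pi) = ell_g k \<theta> + of_int m * (2 * ell_K k)"
proof (induction m rule: int_induct[where k = 0])
  case (step1 i)
  then show ?case
    using ell_g_add_pi[OF assms, of "\<theta> + of_int i * pi"] by (simp add: algebra_simps)
next
  case (step2 i)
  then show ?case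
    using ell_g_add_pi[OF assms, of "\<theta> + of_int (i - 1) * pi"] by (simp add: algebra_simps)
qed simp

lemma am_add_nK:
  assumes "\<bar>k\<bar> < 1"
  shows "am k (u + of_int m * (2 * ell_K k)) = am k u + of_int m * pi"
  by (metis am_ell_g assms ell_g_add_npi ell_g_am)

lemma cis_eq_iff: "cis (2 * x) = cis (2 * y) \<longleftrightarrow> (\<exists>m::int. x = y + of_int m * pi)"
proof -
  have "cis (2 * x) = cis (2 * y) \<longleftrightarrow> (\<exists>m::int. 2 * x = 2 * y + 2 * pi * of_int m)"
    unfolding cis_conv_exp exp_eq by (auto simp: complex_eq_iff algebra_simps)
  also have "\<dots> \<longleftrightarrow> (\<exists>m::int. x = y + of_int m * pi)"
    by (intro iff_exI) (simp add: algebra_simps, linarith)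
  finally show ?thesis .
qed

lemma psi_cis:
  assumes "\<bar>k\<bar> < 1"
  shows "psi k \<alpha> (cis (2 * \<theta>)) = cis (2 * am k (ell_g k \<theta> + ell_g k \<alpha>))"
proof -
  define \<theta>' where "\<theta>' = (SOME \<theta>'. cis (2 * \<theta>) = cis (2 * \<theta>'))"
  have "cis (2 * \<theta>) = cis (2 * \<theta>')"
    unfolding \<theta>'_def by (rule someI[of _ \<theta>]) simp
  then obtain m :: int where m: "\<theta>' = \<theta> + of_int m * pi"
    by (metis cis_eq_iff)
  have "am k (ell_g k \<theta>' + ell_g k \<alpha>) = am k (ell_g k \<theta> + ell_g k \<alpha>) + of_int m * pi"
    using am_add_nK[OF assms, of "ell_g k \<theta> + ell_g k \<alpha>" m]
    unfolding m ell_g_add_npi[OF assms] by (simp add: add_ac)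
  then have "cis (2 * am k (ell_g k \<theta>' + ell_g k \<alpha>)) = cis (2 * am k (ell_g k \<theta> + ell_g k \<alpha>))"
    using cis_eq_iff by blast
  then show ?thesis by (simp add: psi_def \<theta>'_def)
qed

lemma unit_circle_cis: "z \<in> unit_circle \<Longrightarrow> \<exists>\<theta>. z = cis (2 * \<theta>)"
  by (metis cis_Arg_unique complex_unit_circle rcis_cmod_Arg rcis_def mem_sphere_0 mult_1 of_real_1
        nonzero_mult_div_cancel_left times_divide_eq_right zero_neq_numeral)

lemma psi_compose:
  assumes "\<bar>k\<bar> < 1"
  shows "compose unit_circle (psi k \<alpha>) (psi k \<beta>) = psi k (am k (ell_g k \<alpha> + ell_g k \<beta>))"
proof
  fix z
  show "compose unit_circle (psi k \<alpha>) (psi k \<beta>) z = psi k (am k (ell_g k \<alpha> + ell_g k \<beta>)) z"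
  proof (cases "z \<in> unit_circle")
    case True
    then obtain \<theta> where "z = cis (2 * \<theta>)" using unit_circle_cis by blast
    with True show ?thesis
      by (simp add: compose_def psi_cis assms add_ac)
  qed (simp add: compose_def psi_def)
qed

lemma psi_0: "\<bar>k\<bar> < 1 \<Longrightarrow> psi k 0 = (\<lambda>z\<in>unit_circle. z)"
proof
  fix z assume k: "\<bar>k\<bar> < 1"
  show "psi k 0 z = (\<lambda>z\<in>unit_circle. z) z"
  proof (cases "z \<in> unit_circle")
    case True
    then obtain \<theta> where "z = cis (2 * \<theta>)" using unit_circle_cis by blast
    with True k show ?thesis by (simp add: psi_cis)
  qed (simp add: psi_def)
qed

lemma psi_shift: "\<bar>k\<bar> < 1 \<Longrightarrow> psi k (\<alpha> + of_int m * pi) = psi k \<alpha>"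
proof
  fix z assume k: "\<bar>k\<bar> < 1"
  show "psi k (\<alpha> + of_int m * pi) z = psi k \<alpha> z"
  proof (cases "z \<in> unit_circle")
    case True
    then obtain \<theta> where z: "z = cis (2 * \<theta>)" using unit_circle_cis by blast
    have "ell_g k \<theta> + ell_g k (\<alpha> + of_int m * pi) = ell_g k \<theta> + ell_g k \<alpha> + of_int m * (2 * ell_K k)"
      by (simp add: ell_g_add_npi[OF k])
    then show ?thesis
      unfolding z psi_cis[OF k] using am_add_nK[OF k] cis_eq_iff by metis
  qed (simp add: psi_def)
qed

lemma psi_range:
  assumes "\<bar>k\<bar> < 1" shows "psi k \<alpha> \<in> psi k ` {- pi / 2<..pi / 2}"
proof -
  define m where "m = \<lceil>\<alpha> / pi - 1 / 2\<rceil>"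
  have "of_int m - 1 < \<alpha> / pi - 1 / 2" "\<alpha> / pi - 1 / 2 \<le> of_int m"
    unfolding m_def by linarith+
  then have "\<alpha> + of_int (- m) * pi \<in> {- pi / 2<..pi / 2}"
    by (simp add: field_simps)
  then show ?thesis using psi_shift[OF assms, of \<alpha> "- m"] by (metis imageI)
qed

lemma psi_Bij:
  assumes "\<bar>k\<bar> < 1" shows "psi k \<alpha> \<in> Bij unit_circle"
proof -
  have f: "psi k \<beta> z \<in> unit_circle" if "z \<in> unit_circle" for \<beta> z
    using that by (auto simp: psi_def Let_def)
  have i: "psi k \<beta> (psi k (- \<beta>) z) = z" if "z \<in> unit_circle" for \<beta> z
    using fun_cong[OF psi_compose[OF assms, of \<beta> "- \<beta>"], of z] that assms
      am_ell_g[OF assms, of 0]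
    by (simp add: compose_def ell_g_minus[OF assms] psi_0 del: am_ell_g)
  have "bij_betw (psi k \<alpha>) unit_circle unit_circle"
    using f i[of _ \<alpha>] i[of _ "- \<alpha>"]
    by (intro bij_betw_byWitness[where f' = "psi k (- \<alpha>)"]) auto
  then show ?thesis by (auto simp: Bij_def psi_def)
qed

lemma comm_group_circle_group:
  assumes "\<bar>k\<bar> < 1"
  shows "comm_group (circle_group k)"
proof (rule comm_groupI)
  have c: "carrier (circle_group k) = range (psi k)"
    using psi_range[OF assms] by (auto simp: circle_group_def)
  have m: "psi k \<alpha> \<otimes>\<^bsub>circle_group k\<^esub> psi k \<beta> = psi k (am k (ell_g k \<alpha> + ell_g k \<beta>))" for \<alpha> \<beta>
    using psi_Bij[OF assms] by (simp add: circle_group_def BijGroup_def psi_compose assms)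
  have o: "\<one>\<^bsub>circle_group k\<^esub> = psi k 0"
    by (simp add: circle_group_def BijGroup_def psi_0 assms)
  have z: "am k 0 = 0" using am_ell_g[OF assms, of 0] by simp
  show "\<exists>y\<in>carrier (circle_group k). y \<otimes>\<^bsub>circle_group k\<^esub> x = \<one>\<^bsub>circle_group k\<^esub>"
    if "x \<in> carrier (circle_group k)" for x
  proof -
    from that obtain \<alpha> where "x = psi k \<alpha>" by (auto simp: c)
    then have "psi k (- \<alpha>) \<otimes>\<^bsub>circle_group k\<^esub> x = \<one>\<^bsub>circle_group k\<^esub>"
      by (simp add: m o ell_g_minus[OF assms] z)
    then show ?thesis by (auto simp: c)
  qed
qed (use assms in \<open>auto simp: circle_group_def BijGroup_def psi_Bij psi_compose psi_range[simplified] psi_0[symmetric] add_ac\<close>)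

lemma pencil_circle_0:
  assumes "\<bar>k\<bar> < 1"
  shows "pencil_circle k 0 = unit_circle"
  using am_ell_g[OF assms, of 0]
  by (simp add: pencil_circle_def pencil_center_def pencil_radius_def dn_def sn_def cn_def)

lemma pencil_circle_ell_K:
  assumes "\<bar>k\<bar> < 1"
  shows "pencil_circle k (ell_K k) =
    {complex_of_real ((sqrt (1 - k\<^sup>2) - 1) / (sqrt (1 - k\<^sup>2) + 1))}"
proof -
  have *: "am k (ell_K k) = pi / 2"
    unfolding ell_K_def by (rule am_ell_g[OF assms])
  show ?thesis
    unfolding pencil_circle_def pencil_center_def pencil_radius_def dn_def sn_def cn_def * by simp
qed

end

theory Submission
  imports Defs
begin

text \<open>Parametrise the unit circle by \<open>u \<mapsto> cis (2 am u)\<close>, which has period \<open>2K\<close>. By the addition theorem,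
  \<open>cn u cn v + dn (u - v) sn u sn v = cn (u - v)\<close>, and this says exactly that the chord from \<open>u\<close> to
  \<open>u + a\<close> touches \<open>C\<^sub>a\<close>; so every chord of the unit circle touches a circle of the pencil, which settles
  the diagonals. Conversely, for fixed \<open>u\<close> the tangency condition on \<open>(cn v, sn v)\<close> is linear up to sign
  and a line meets a circle at most twice, so \<open>u + a\<close> and \<open>u - a\<close> are the only endpoints of tangent
  chords from \<open>u\<close>. As an interscribed polygon has distinct vertices, it never turns back, so its vertices
  are \<open>u, u + e, u + 2e, \<dots>\<close> with a fixed \<open>e = \<plusminus>a\<close>, and it closes after exactly \<open>n\<close> steps iff \<open>a\<close>
  has order \<open>n\<close> modulo \<open>2K\<close>.\<close>

section \<open>Derivatives and parity of the Jacobi functions\<close>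

lemma dn_pos: "\<bar>k\<bar> < 1 \<Longrightarrow> 0 < dn k u"
  unfolding dn_def sn_def by (intro real_sqrt_gt_zero modulus_pos)

lemma dn_sq: "\<bar>k\<bar> < 1 \<Longrightarrow> (dn k u)\<^sup>2 = 1 - k\<^sup>2 * (sn k u)\<^sup>2"
  using modulus_pos[of k "am k u"] by (simp add: dn_def sn_def)

lemma cn_sq: "(cn k u)\<^sup>2 = 1 - (sn k u)\<^sup>2"
  by (simp add: sn_def cn_def cos_squared_eq)

text \<open>The inverse function rule turns the integrand of \<open>ell_g\<close> into its
  reciprocal, which is \<open>dn\<close>.\<close>

lemma am_deriv:
  assumes "\<bar>k\<bar> < 1"
  shows "(am k has_real_derivative dn k u) (at u)"
proof -
  have cont: "isCont (am k) u"
  proof -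
    have "isCont (am k) (ell_g k (am k u))"
      by (rule isCont_inverse_function[where d = 1])
        (auto intro!: DERIV_isCont ell_g_deriv simp: assms)
    then show ?thesis using assms by simp
  qed
  have "(am k has_real_derivative inverse (1 / sqrt (1 - k\<^sup>2 * (sin (am k u))\<^sup>2))) (at u)"
    using assms modulus_pos[OF assms, of "am k u"]
    by (intro DERIV_inverse_function[where f = "ell_g k" and a = "u - 1" and b = "u + 1"]
        ell_g_deriv cont) auto
  then show ?thesis by (simp add: dn_def sn_def)
qed

lemma sn_deriv: "\<bar>k\<bar> < 1 \<Longrightarrow> (sn k has_real_derivative cn k u * dn k u) (at u)"
  unfolding sn_def[abs_def] cn_def by (rule DERIV_chain2[OF DERIV_sin am_deriv])

lemma cn_deriv: "\<bar>k\<bar> < 1 \<Longrightarrow> (cn k has_real_derivative - sn k u * dn k u) (at u)"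
  unfolding sn_def cn_def[abs_def] by (rule DERIV_chain2[OF DERIV_cos am_deriv])

lemma dn_deriv:
  assumes "\<bar>k\<bar> < 1"
  shows "(dn k has_real_derivative - k\<^sup>2 * sn k u * cn k u) (at u)"
proof -
  have pos: "0 < 1 - k\<^sup>2 * (sn k u)\<^sup>2" unfolding sn_def by (rule modulus_pos[OF assms])
  have "((\<lambda>u. sqrt (1 - k\<^sup>2 * (sn k u)\<^sup>2)) has_real_derivative
      - (k\<^sup>2 * (2 * sn k u * (cn k u * dn k u))) * inverse (2 * dn k u)) (at u)"
    using pos by (auto intro!: derivative_eq_intros sn_deriv[OF assms] simp: dn_def divide_simps)
  moreover have "dn k = (\<lambda>u. sqrt (1 - k\<^sup>2 * (sn k u)\<^sup>2))" by (simp add: dn_def[abs_def])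
  ultimately show ?thesis
    using dn_pos[OF assms, of u] by (simp add: field_simps)
qed

lemma am_minus: "\<bar>k\<bar> < 1 \<Longrightarrow> am k (- u) = - am k u"
  by (metis am_ell_g ell_g_am ell_g_minus)

lemma sn_minus: "\<bar>k\<bar> < 1 \<Longrightarrow> sn k (- u) = - sn k u"
  by (simp add: sn_def am_minus)

lemma cn_minus: "\<bar>k\<bar> < 1 \<Longrightarrow> cn k (- u) = cn k u"
  by (simp add: cn_def am_minus)

lemma dn_minus: "\<bar>k\<bar> < 1 \<Longrightarrow> dn k (- u) = dn k u"
  by (simp add: dn_def sn_minus)

lemma am_0: "\<bar>k\<bar> < 1 \<Longrightarrow> am k 0 = 0"
  using am_ell_g[of k 0] by simp

section \<open>The addition theorem for cn and dn\<close>

lemma addition_denominator_pos: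
  assumes "\<bar>k\<bar> < 1"
  shows "0 < 1 - k\<^sup>2 * (sn k u)\<^sup>2 * (sn k v)\<^sup>2"
proof -
  have "k\<^sup>2 * (sn k u)\<^sup>2 * (sn k v)\<^sup>2 \<le> k\<^sup>2 * (sn k u)\<^sup>2"
    by (simp add: mult_left_le sn_def abs_square_le_1)
  then show ?thesis using modulus_pos[OF assms, of "am k u"] by (simp add: sn_def)
qed

text \<open>The last hypothesis makes the numerator in the quotient rule vanish; stated without
  division, it can be checked as a polynomial identity.\<close>

lemma quotient_const:
  fixes N D N' D' :: "real \<Rightarrow> real"
  assumes "\<And>x. (N has_real_derivative N' x) (at x)" "\<And>x. (D has_real_derivative D' x) (at x)"
    and "\<And>x. D x \<noteq> 0" "\<And>x. N' x * D x = N x * D' x"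
  shows "N x / D x = N y / D y"
proof (rule DERIV_zero_eq[of "\<lambda>x. N x / D x"])
  show "((\<lambda>x. N x / D x) has_real_derivative 0) (at x)" for x
    using DERIV_divide[OF assms(1,2,3), of x] assms(4)[of x] by simp
qed

text \<open>With \<open>s1, c1, d1\<close> for sn, cn, dn at \<open>u\<close> and
  \<open>s2, c2, d2\<close> at \<open>c - u\<close>, this is the last hypothesis of
  \<open>quotient_const\<close> for the cn quotient: the first factor on the left is the derivative
  of \<open>c1 * c2 - s1 * s2 * d1 * d2\<close>, the last on the right that of the
  denominator.\<close>

lemma cn_addition_algebra:
  fixes s1 s2 c1 c2 d1 d2 k :: real
  assumes "c1\<^sup>2 = 1 - s1\<^sup>2" "c2\<^sup>2 = 1 - s2\<^sup>2"
    and "d1\<^sup>2 = 1 - k\<^sup>2 * s1\<^sup>2" "d2\<^sup>2 = 1 - k\<^sup>2 * s2\<^sup>2"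
  shows "(c1 * s2 * d2 - s1 * d1 * c2 - (c1 * d1 * s2 * d1 * d2 - s1 * c2 * d2 * d1 * d2
      - s1 * s2 * k\<^sup>2 * s1 * c1 * d2 + s1 * s2 * d1 * k\<^sup>2 * s2 * c2)) * (1 - k\<^sup>2 * s1\<^sup>2 * s2\<^sup>2) =
    (c1 * c2 - s1 * s2 * d1 * d2) * (- 2 * k\<^sup>2 * s1 * s2 * (c1 * d1 * s2 - s1 * c2 * d2))"
  using assms by Groebner_Basis.algebra

text \<open>The counterpart for the dn quotient, with numerator
  \<open>d1 * d2 - k\<^sup>2 * s1 * s2 * c1 * c2\<close>.\<close>

lemma dn_addition_algebra:
  fixes s1 s2 c1 c2 d1 d2 k :: real
  assumes "c1\<^sup>2 = 1 - s1\<^sup>2" "c2\<^sup>2 = 1 - s2\<^sup>2"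
    and "d1\<^sup>2 = 1 - k\<^sup>2 * s1\<^sup>2" "d2\<^sup>2 = 1 - k\<^sup>2 * s2\<^sup>2"
  shows "(d1 * k\<^sup>2 * s2 * c2 - k\<^sup>2 * s1 * c1 * d2 - k\<^sup>2 * (c1 * d1 * s2 * c1 * c2 - s1 * c2 * d2 * c1 * c2
      - s1 * s2 * s1 * d1 * c2 + s1 * s2 * c1 * s2 * d2)) * (1 - k\<^sup>2 * s1\<^sup>2 * s2\<^sup>2) =
    (d1 * d2 - k\<^sup>2 * s1 * s2 * c1 * c2) * (- 2 * k\<^sup>2 * s1 * s2 * (c1 * d1 * s2 - s1 * c2 * d2))"
  using assms by Groebner_Basis.algebra

context
  fixes k c :: real
  assumes k: "\<bar>k\<bar> < 1"
begin

lemma cn_reflect_deriv: "((\<lambda>u. cn k (c - u)) has_real_derivative sn k (c - u) * dn k (c - u)) (at u)"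
  by (rule DERIV_cong[OF DERIV_chain2[OF cn_deriv[OF k], of "\<lambda>u. c - u" "- 1"]])
    (auto intro!: derivative_eq_intros)

lemma sn_reflect_deriv: "((\<lambda>u. sn k (c - u)) has_real_derivative - cn k (c - u) * dn k (c - u)) (at u)"
  by (rule DERIV_cong[OF DERIV_chain2[OF sn_deriv[OF k], of "\<lambda>u. c - u" "- 1"]])
    (auto intro!: derivative_eq_intros)

lemma dn_reflect_deriv: "((\<lambda>u. dn k (c - u)) has_real_derivative k\<^sup>2 * sn k (c - u) * cn k (c - u)) (at u)"
  by (rule DERIV_cong[OF DERIV_chain2[OF dn_deriv[OF k], of "\<lambda>u. c - u" "- 1"]])
    (auto intro!: derivative_eq_intros)

lemma denominator_deriv:
  "((\<lambda>u. 1 - k\<^sup>2 * (sn k u)\<^sup>2 * (sn k (c - u))\<^sup>2) has_real_derivative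
    - 2 * k\<^sup>2 * sn k u * sn k (c - u) *
      (cn k u * dn k u * sn k (c - u) - sn k u * cn k (c - u) * dn k (c - u))) (at u)"
  by (auto intro!: derivative_eq_intros sn_deriv[OF k] sn_reflect_deriv)
    (simp add: algebra_simps power2_eq_square)

text \<open>The addition theorem: with \<open>u + v = c\<close> fixed, the quotient has derivative \<open>0\<close> in \<open>u\<close>.\<close>

lemma cn_quotient_const:
  "(cn k u * cn k (c - u) - sn k u * sn k (c - u) * dn k u * dn k (c - u)) /
      (1 - k\<^sup>2 * (sn k u)\<^sup>2 * (sn k (c - u))\<^sup>2) = cn k c"
proof -
  let ?N = "\<lambda>u. cn k u * cn k (c - u) - sn k u * sn k (c - u) * dn k u * dn k (c - u)"
  let ?N' = "\<lambda>u. cn k u * sn k (c - u) * dn k (c - u) - sn k u * dn k u * cn k (c - u) - (cn k u * dn k u * sn k (c - u) * dn k u * dn k (c - u) - sn k u * cn k (c - u) * dn k (c - u) * dn k u * dn k (c - u)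
      - sn k u * sn k (c - u) * k\<^sup>2 * sn k u * cn k u * dn k (c - u) + sn k u * sn k (c - u) * dn k u * k\<^sup>2 * sn k (c - u) * cn k (c - u))"
  let ?D = "\<lambda>u. 1 - k\<^sup>2 * (sn k u)\<^sup>2 * (sn k (c - u))\<^sup>2"
  let ?D' = "\<lambda>u. - 2 * k\<^sup>2 * sn k u * sn k (c - u) *
      (cn k u * dn k u * sn k (c - u) - sn k u * cn k (c - u) * dn k (c - u))"
  \<comment> \<open>At 0 the functions sn and cn take the values 0 and 1, so the constant is cn at
    \<open>c\<close>.\<close>
  have "?N u / ?D u = ?N 0 / ?D 0"
  proof (rule quotient_const[of ?N ?N' ?D ?D'])
    fix x
    show "(?N has_real_derivative ?N' x) (at x)"
      apply (rule derivative_eq_intros cn_deriv[OF k] sn_deriv[OF k] dn_deriv[OF k]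
          cn_reflect_deriv sn_reflect_deriv dn_reflect_deriv refl)+
      by (simp add: algebra_simps)
    show "?N' x * ?D x = ?N x * ?D' x"
      by (rule cn_addition_algebra) (rule cn_sq dn_sq[OF k])+
    show "?D x \<noteq> 0" using addition_denominator_pos[OF k, of x "c - x"] by simp
    show "(?D has_real_derivative ?D' x) (at x)" by (rule denominator_deriv)
  qed
  then show ?thesis by (simp add: sn_def cn_def am_0[OF k])
qed

text \<open>Again the derivative vanishes while the sum of the arguments stays fixed. The formula
  supplies the dn factor in \<open>cn_diff_identity\<close>.\<close>

lemma dn_quotient_const:
  "(dn k u * dn k (c - u) - k\<^sup>2 * sn k u * sn k (c - u) * cn k u * cn k (c - u)) /
      (1 - k\<^sup>2 * (sn k u)\<^sup>2 * (sn k (c - u))\<^sup>2) = dn k c"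
proof -
  let ?N = "\<lambda>u. dn k u * dn k (c - u) - k\<^sup>2 * sn k u * sn k (c - u) * cn k u * cn k (c - u)"
  let ?N' = "\<lambda>u. dn k u * k\<^sup>2 * sn k (c - u) * cn k (c - u) - k\<^sup>2 * sn k u * cn k u * dn k (c - u) - k\<^sup>2 * (cn k u * dn k u * sn k (c - u) * cn k u * cn k (c - u) - sn k u * cn k (c - u) * dn k (c - u) * cn k u * cn k (c - u)
      - sn k u * sn k (c - u) * sn k u * dn k u * cn k (c - u) + sn k u * sn k (c - u) * cn k u * sn k (c - u) * dn k (c - u))"
  let ?D = "\<lambda>u. 1 - k\<^sup>2 * (sn k u)\<^sup>2 * (sn k (c - u))\<^sup>2"
  let ?D' = "\<lambda>u. - 2 * k\<^sup>2 * sn k u * sn k (c - u) *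
      (cn k u * dn k u * sn k (c - u) - sn k u * cn k (c - u) * dn k (c - u))"
  have "?N u / ?D u = ?N 0 / ?D 0"
  proof (rule quotient_const[of ?N ?N' ?D ?D'])
    fix x
    show "(?N has_real_derivative ?N' x) (at x)"
      apply (rule derivative_eq_intros cn_deriv[OF k] sn_deriv[OF k] dn_deriv[OF k]
          cn_reflect_deriv sn_reflect_deriv dn_reflect_deriv refl)+
      by (simp add: algebra_simps)
    show "?N' x * ?D x = ?N x * ?D' x"
      by (rule dn_addition_algebra) (rule cn_sq dn_sq[OF k])+
    show "?D x \<noteq> 0" using addition_denominator_pos[OF k, of x "c - x"] by simp
    show "(?D has_real_derivative ?D' x) (at x)" by (rule denominator_deriv)
  qed
  then show ?thesis by (simp add: sn_def cn_def dn_def am_0[OF k])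
qed

end

text \<open>Once \<open>u\<close> and \<open>u - v\<close> are fixed, this mixed form is linear in
  cn and sn at \<open>v\<close>, the shape that the tangency condition has.\<close>

lemma cn_diff_identity:
  assumes k: "\<bar>k\<bar> < 1"
  shows "cn k u * cn k v + dn k (u - v) * sn k u * sn k v = cn k (u - v)"
proof -
  define D where "D = 1 - k\<^sup>2 * (sn k u)\<^sup>2 * (sn k v)\<^sup>2"
  have D: "D \<noteq> 0" using addition_denominator_pos[OF k, of u v] by (simp add: D_def)
  \<comment> \<open>For the sum \<open>u - v\<close> the second argument is \<open>- v\<close>;
    parity then adjusts the signs.\<close>
  have "cn k (u - v) * D = cn k u * cn k v + sn k u * sn k v * dn k u * dn k v"
    using cn_quotient_const[OF k, of u "u - v"] D
    by (simp add: sn_minus cn_minus dn_minus k D_def divide_simps)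
  moreover have "dn k (u - v) * D = dn k u * dn k v + k\<^sup>2 * sn k u * sn k v * cn k u * cn k v"
    using dn_quotient_const[OF k, of u "u - v"] D
    by (simp add: sn_minus cn_minus dn_minus k D_def divide_simps)
  \<comment> \<open>The two terms in \<open>k\<^sup>2 * (sn k u)\<^sup>2 * (sn k v)\<^sup>2 * cn k u
    * cn k v\<close> cancel.\<close>
  ultimately have "(cn k u * cn k v + dn k (u - v) * sn k u * sn k v) * D = cn k (u - v) * D"
    unfolding D_def by Groebner_Basis.algebra
  then show ?thesis using D by simp
qed

section \<open>Tangency of a chord to a circle centred on the real axis\<close>

lemma ex1_range:
  assumes "inj f"
  shows "(\<exists>!x. x \<in> range f \<inter> S) \<longleftrightarrow> (\<exists>!t. f t \<in> S)"
proof
  assume "\<exists>!x. x \<in> range f \<inter> S"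
  then show "\<exists>!t. f t \<in> S"
  proof (rule ex1E)
    fix x assume x: "x \<in> range f \<inter> S" and uniq: "\<forall>y. y \<in> range f \<inter> S \<longrightarrow> y = x"
    then obtain t where t: "x = f t" by blast
    show ?thesis
    proof (rule ex1I[of _ t])
      show "f t \<in> S" using x t by simp
      show "y = t" if "f y \<in> S" for y
        using uniq[rule_format, of "f y"] that t by (intro injD[OF assms]) simp
    qed
  qed
next
  assume "\<exists>!t. f t \<in> S"
  then show "\<exists>!x. x \<in> range f \<inter> S"
  proof (rule ex1E)
    fix t assume t: "f t \<in> S" and uniq: "\<forall>y. f y \<in> S \<longrightarrow> y = t"
    show ?thesis
    proof (rule ex1I[of _ "f t"])
      show "f t \<in> range f \<inter> S" using t by simp
      show "x = f t" if x: "x \<in> range f \<inter> S" for x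
      proof -
        obtain y where y: "x = f y" using x by blast
        then have "y = t" using uniq[rule_format, of y] x by simp
        then show ?thesis using y by simp
      qed
    qed
  qed
qed

text \<open>The bracket is, up to sign, the distance from the centre to the line through the
  endpoints. For \<open>r = 0\<close> the condition says that the line passes through the
  centre.\<close>

lemma line_tangent_sphere_iff:
  fixes c r :: real
  assumes ne: "cis (2 * \<theta>) \<noteq> cis (2 * \<phi>)" and r: "0 \<le> r"
  shows "line_tangent (cis (2 * \<theta>)) (cis (2 * \<phi>)) (sphere (complex_of_real c) r) \<longleftrightarrow>
    ((1 - c) * cos \<theta> * cos \<phi> + (1 + c) * sin \<theta> * sin \<phi>)\<^sup>2 = r\<^sup>2"
proof -
  \<comment> \<open>the chord has normal direction \<open>cis (\<theta> + \<phi>)\<close> and signed distance \<open>cos (\<theta> - \<phi>)\<close> from \<open>0\<close>\<close>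
  define X where "X t = cis (\<theta> + \<phi>) * Complex (cos (\<theta> - \<phi>)) t" for t
  define E where "E = (1 - c) * cos \<theta> * cos \<phi> + (1 + c) * sin \<theta> * sin \<phi>"
  have inj: "inj X" by (auto simp: inj_def X_def)
  have p: "cis (2 * \<theta>) = X (sin (\<theta> - \<phi>))"
    by (simp add: X_def cis.code[symmetric] cis_mult flip: cis.ctr)
  have q: "cis (2 * \<phi>) = X (- sin (\<theta> - \<phi>))"
    using cis_mult[of "\<theta> + \<phi>" "\<phi> - \<theta>"] by (simp add: X_def cis.ctr cos_diff sin_diff mult.commute)
  have s: "sin (\<theta> - \<phi>) \<noteq> 0" using ne p q by force
  have aff: "u *\<^sub>R X x + v *\<^sub>R X y = X (u * x + v * y)" if "u + v = 1" for u v x y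
  proof -
    have "u *\<^sub>R Complex a x + v *\<^sub>R Complex a y = Complex a (u * x + v * y)" for a
      using that by (simp add: complex_eq_iff flip: distrib_right)
    then show ?thesis
      by (metis X_def mult_scaleR_right distrib_left)
  qed
  have hull: "affine hull {cis (2 * \<theta>), cis (2 * \<phi>)} = range X"
  proof -
    \<comment> \<open>The weights solve \<open>u + v = 1\<close> and
      \<open>(u - v) * sin (\<theta> - \<phi>) = t\<close>.\<close>
    have "\<exists>u v. X t = u *\<^sub>R X (sin (\<theta> - \<phi>)) + v *\<^sub>R X (- sin (\<theta> - \<phi>)) \<and> u + v = 1" for t
      using s by (intro exI[of _ "(1 + t / sin (\<theta> - \<phi>)) / 2"] exI[of _ "(1 - t / sin (\<theta> - \<phi>)) / 2"])
        (subst aff, auto simp: field_simps)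
    then show ?thesis unfolding affine_hull_2 p q using aff by auto
  qed
  have dist: "X t \<in> sphere (complex_of_real c) r \<longleftrightarrow> E\<^sup>2 + (t + c * sin (\<theta> + \<phi>))\<^sup>2 = r\<^sup>2" for t
  proof -
    have "X t \<in> sphere (complex_of_real c) r \<longleftrightarrow> (cmod (X t - complex_of_real c))\<^sup>2 = r\<^sup>2"
      using r by (simp add: dist_norm norm_minus_commute)
    \<comment> \<open>Factoring out the rotation puts the centre into coordinates across and along
      the chord.\<close>
    also have "X t - complex_of_real c
        = cis (\<theta> + \<phi>) * (Complex (cos (\<theta> - \<phi>)) t - complex_of_real c * cis (- (\<theta> + \<phi>)))"
      by (simp add: X_def right_diff_distrib cis_mult mult.left_commute)
    also have "(cmod \<dots>)\<^sup>2 = (cos (\<theta> - \<phi>) - c * cos (\<theta> + \<phi>))\<^sup>2 + (t + c * sin (\<theta> + \<phi>))\<^sup>2"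
      by (simp only: norm_mult norm_cis mult_1 cmod_power2) (simp flip: minus_add_distrib)
    also have "cos (\<theta> - \<phi>) - c * cos (\<theta> + \<phi>) = E"
      by (simp add: E_def cos_diff cos_add algebra_simps)
    finally show ?thesis .
  qed
  have "line_tangent (cis (2 * \<theta>)) (cis (2 * \<phi>)) (sphere (complex_of_real c) r)
      \<longleftrightarrow> (\<exists>!t. X t \<in> sphere (complex_of_real c) r)"
    unfolding line_tangent_def hull ex1_range[OF inj] using ne by simp
  also have "\<dots> \<longleftrightarrow> E\<^sup>2 = r\<^sup>2"
  proof
    assume "E\<^sup>2 = r\<^sup>2"
    then show "\<exists>!t. X t \<in> sphere (complex_of_real c) r"
      unfolding dist
      by (intro ex1I[of _ "- (c * sin (\<theta> + \<phi>))"]) (simp_all add: eq_neg_iff_add_eq_0)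
  next
    assume "\<exists>!t. X t \<in> sphere (complex_of_real c) r"
    then obtain t where t: "\<And>t'. E\<^sup>2 + (t' + c * sin (\<theta> + \<phi>))\<^sup>2 = r\<^sup>2 \<longleftrightarrow> t' = t"
      unfolding dist by metis
    \<comment> \<open>Reflecting \<open>t\<close> in the foot of the perpendicular from the centre
      again gives a solution. Uniqueness makes \<open>t\<close> the foot itself, where the second
      square vanishes.\<close>
    have "E\<^sup>2 + ((- t - 2 * (c * sin (\<theta> + \<phi>))) + c * sin (\<theta> + \<phi>))\<^sup>2 = r\<^sup>2"
      using t[of t] by (simp add: power2_eq_square algebra_simps)
    then have "- t - 2 * (c * sin (\<theta> + \<phi>)) = t" by (rule iffD1[OF t])
    then have "t + c * sin (\<theta> + \<phi>) = 0" by linarith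
    then show "E\<^sup>2 = r\<^sup>2" using t[of t] by simp
  qed
  finally show ?thesis by (simp add: E_def)
qed

section \<open>The elliptic parameter on the unit circle, and tangency to pencil circles\<close>

definition jacobi_point :: "real \<Rightarrow> real \<Rightarrow> complex" where
  "jacobi_point k u = cis (2 * am k u)"

text \<open>Equal points have amplitudes that differ by a multiple of pi, and each pi adds
  \<open>2 * ell_K k\<close> to \<open>ell_g\<close>.\<close>

lemma jacobi_point_eq_iff:
  assumes "\<bar>k\<bar> < 1"
  shows "jacobi_point k u = jacobi_point k v \<longleftrightarrow> (\<exists>m::int. u = v + of_int m * (2 * ell_K k))"
  unfolding jacobi_point_def cis_eq_iff using assms by (metis am_add_nK ell_g_am)

lemma unit_circle_jacobi_point:
  "\<bar>k\<bar> < 1 \<Longrightarrow> z \<in> unit_circle \<Longrightarrow> \<exists>u. z = jacobi_point k u"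
  unfolding jacobi_point_def by (metis unit_circle_cis am_ell_g)

text \<open>The half-angles of the endpoints are the amplitudes of \<open>u\<close> and
  \<open>v\<close>. One minus the centre, one plus the centre and the radius share the factor
  \<open>2 / (1 + dn k a)\<close>, which cancels.\<close>

lemma line_tangent_pencil_iff:
  assumes k: "\<bar>k\<bar> < 1" and ne: "jacobi_point k u \<noteq> jacobi_point k v" and a: "0 \<le> cn k a"
  shows "line_tangent (jacobi_point k u) (jacobi_point k v) (pencil_circle k a) \<longleftrightarrow>
    (cn k u * cn k v + dn k a * sn k u * sn k v)\<^sup>2 = (cn k a)\<^sup>2"
proof -
  have d: "0 < 1 + dn k a" using dn_pos[OF k, of a] by simp
  let ?c = "(dn k a - 1) / (dn k a + 1)"
  have "1 - ?c = 2 / (1 + dn k a)" "1 + ?c = 2 * dn k a / (1 + dn k a)"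
    using d by (simp_all add: field_simps)
  then have E: "(1 - ?c) * cn k u * cn k v + (1 + ?c) * sn k u * sn k v =
      2 / (1 + dn k a) * (cn k u * cn k v + dn k a * sn k u * sn k v)"
    by (simp only:) (simp add: add_divide_distrib distrib_left)
  have r: "pencil_radius k a = 2 / (1 + dn k a) * cn k a"
    by (simp add: pencil_radius_def)
  have "0 \<le> pencil_radius k a" using a d by (simp add: pencil_radius_def)
  then have "line_tangent (jacobi_point k u) (jacobi_point k v) (pencil_circle k a) \<longleftrightarrow>
      ((1 - ?c) * cn k u * cn k v + (1 + ?c) * sn k u * sn k v)\<^sup>2 = (pencil_radius k a)\<^sup>2"
    unfolding pencil_circle_def pencil_center_def jacobi_point_def cn_def[of k u] cn_def[of k v]
      sn_def[of k u] sn_def[of k v]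
    by (rule line_tangent_sphere_iff[OF ne[unfolded jacobi_point_def]])
  also have "\<dots> \<longleftrightarrow> (cn k u * cn k v + dn k a * sn k u * sn k v)\<^sup>2 = (cn k a)\<^sup>2"
    unfolding E r power_mult_distrib using d by simp
  finally show ?thesis .
qed

section \<open>Tangent chords as shifts of the parameter\<close>

lemma line_circle_two_points:
  fixes A B C x y :: real
  assumes "A \<noteq> 0 \<or> B \<noteq> 0"
    and "x\<^sup>2 + y\<^sup>2 = 1" "x1\<^sup>2 + y1\<^sup>2 = 1" "x2\<^sup>2 + y2\<^sup>2 = 1"
    and "A * x + B * y = C" "A * x1 + B * y1 = C" "A * x2 + B * y2 = C"
    and "x1 \<noteq> x2 \<or> y1 \<noteq> y2"
  shows "x = x1 \<and> y = y1 \<or> x = x2 \<and> y = y2"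
proof -
  \<comment> \<open>the coordinate along the line, whose square is determined by the circle\<close>
  define t where "t x y = A * y - B * x" for x y
  have n: "A\<^sup>2 + B\<^sup>2 \<noteq> 0" using assms(1) by (simp add: sum_power2_eq_zero_iff)
  have sq: "(t x y)\<^sup>2 = A\<^sup>2 + B\<^sup>2 - C\<^sup>2" if "x\<^sup>2 + y\<^sup>2 = 1" "A * x + B * y = C" for x y
    using that unfolding t_def by Groebner_Basis.algebra
  have eq: "x = x' \<and> y = y'" if "t x y = t x' y'" "A * x + B * y = C" "A * x' + B * y' = C" for x y x' y'
  proof -
    \<comment> \<open>\<open>A * x + B * y\<close> and \<open>t x y\<close> are coordinates in an
      orthogonal frame, with determinant \<open>A\<^sup>2 + B\<^sup>2\<close>.\<close>
    have "(A\<^sup>2 + B\<^sup>2) * (x - x') = 0" "(A\<^sup>2 + B\<^sup>2) * (y - y') = 0"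
      using that unfolding t_def by Groebner_Basis.algebra+
    then show ?thesis using n by (simp del: sum_power2_eq_zero_iff)
  qed
  have "(t x y)\<^sup>2 = (t x1 y1)\<^sup>2" "(t x1 y1)\<^sup>2 = (t x2 y2)\<^sup>2" 
    using sq[OF assms(2,5)] sq[OF assms(3,6)] sq[OF assms(4,7)] by simp_all
  \<comment> \<open>Three numbers with equal squares cannot be pairwise distinct; the third
    coincidence would identify the two given points.\<close>
  then have "t x y = t x1 y1 \<or> t x y = t x2 y2 \<or> t x1 y1 = t x2 y2"
    by (auto simp: power2_eq_iff)
  then show ?thesis
    using eq[OF _ assms(5,6)] eq[OF _ assms(5,7)] eq[OF _ assms(6,7)] assms(8) by blast
qed

lemma ell_K_pos: "\<bar>k\<bar> < 1 \<Longrightarrow> 0 < ell_K k"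
  unfolding ell_K_def using ell_g_expand[of k 0 "pi / 2"] pi_half_gt_zero ell_g_0[of k] by linarith

text \<open>Makes the radii of the pencil nonnegative. As \<open>ell_g\<close> is expanding,
  \<open>am\<close> is monotone and maps [-K, K] into [-pi/2, pi/2].\<close>

lemma cn_nonneg:
  assumes k: "\<bar>k\<bar> < 1" and "\<bar>a\<bar> \<le> ell_K k"
  shows "0 \<le> cn k a"
proof -
  have mono: "am k x \<le> am k y" if "x \<le> y" for x y
    using ell_g_expand[OF k, of "am k y" "am k x"] that k by (cases "am k x \<le> am k y") auto
  have "am k (ell_K k) = pi / 2" unfolding ell_K_def by (rule am_ell_g[OF k])
  then have "- (pi / 2) \<le> am k a" "am k a \<le> pi / 2"
    using mono[of "- ell_K k" a] mono[of a "ell_K k"] am_minus[OF k, of "ell_K k"] assms(2) by linarith+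
  then show ?thesis unfolding cn_def by (rule cos_ge_zero)
qed

lemma jacobi_point_add_cancel:
  "\<bar>k\<bar> < 1 \<Longrightarrow> jacobi_point k (c + u) = jacobi_point k (c + v) \<longleftrightarrow> jacobi_point k u = jacobi_point k v"
  by (simp add: jacobi_point_eq_iff add.assoc)

text \<open>\<open>cn_diff_identity\<close> at \<open>u\<close> and \<open>u + a\<close> is the
  tangency condition before squaring. The endpoint at \<open>v\<close> is compared as a point, so
  that shifts may be reduced modulo 2K.\<close>

lemma line_tangent_pencil_shift:
  assumes k: "\<bar>k\<bar> < 1" and "\<bar>a\<bar> \<le> ell_K k"
    and "jacobi_point k u \<noteq> jacobi_point k v" "jacobi_point k v = jacobi_point k (u + a)"
  shows "line_tangent (jacobi_point k u) (jacobi_point k v) (pencil_circle k a)"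
proof -
  have "cn k u * cn k (u + a) + dn k a * sn k u * sn k (u + a) = cn k a"
    using cn_diff_identity[OF k, of u "u + a"] by (simp add: cn_minus dn_minus k)
  then have "(cn k u * cn k (u + a) + dn k a * sn k u * sn k (u + a))\<^sup>2 = (cn k a)\<^sup>2"
    by (rule arg_cong)
  then show ?thesis
    unfolding assms(4)
    using line_tangent_pencil_iff[OF k assms(3)[unfolded assms(4)] cn_nonneg[OF k assms(2)]]
    by blast
qed

lemma chord_tangent_pencil:
  assumes k: "\<bar>k\<bar> < 1" and "p \<in> unit_circle" "q \<in> unit_circle" "p \<noteq> q"
  shows "\<exists>D\<in>pencil k. line_tangent p q D"
proof -
  obtain u v where uv: "p = jacobi_point k u" "q = jacobi_point k v"
    using unit_circle_jacobi_point[OF k] assms(2,3) by blast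
  have K: "0 < 2 * ell_K k" using ell_K_pos[OF k] by simp
  \<comment> \<open>This rounding brings the shift into the half-open range (-K, K] that
    parametrises the pencil.\<close>
  define m where "m = \<lceil>(v - u) / (2 * ell_K k) - 1 / 2\<rceil>"
  define a where "a = v - u - of_int m * (2 * ell_K k)"
  have "of_int m - 1 < (v - u) / (2 * ell_K k) - 1 / 2" "(v - u) / (2 * ell_K k) - 1 / 2 \<le> of_int m"
    unfolding m_def by linarith+
  then have a: "- ell_K k < a" "a \<le> ell_K k"
    using K by (simp_all add: a_def field_simps)
  have "jacobi_point k v = jacobi_point k (u + a)"
    unfolding jacobi_point_eq_iff[OF k] by (rule exI[of _ m]) (simp add: a_def)
  then have "line_tangent p q (pencil_circle k a)"
    unfolding uv using a assms(4) uv by (intro line_tangent_pencil_shift k) auto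
  then show ?thesis using a by (auto simp: pencil_def)
qed

lemma jacobi_point_neq:
  assumes k: "\<bar>k\<bar> < 1" and "x \<noteq> y" "\<bar>x - y\<bar> < 2 * ell_K k"
  shows "jacobi_point k x \<noteq> jacobi_point k y"
proof
  assume "jacobi_point k x = jacobi_point k y"
  then obtain m :: int where "x = y + of_int m * (2 * ell_K k)"
    unfolding jacobi_point_eq_iff[OF k] ..
  then have m: "x - y = of_int m * (2 * ell_K k)" by simp
  have K: "0 < ell_K k" by (rule ell_K_pos[OF k])
  have "\<bar>of_int m\<bar> * (2 * ell_K k) < 1 * (2 * ell_K k)"
    using assms(3) K unfolding m by (simp add: abs_mult)
  then have "\<bar>of_int m :: real\<bar> < 1" using K by simp
  then have "m = 0" by linarith
  then show False using m assms(2) by simp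
qed

text \<open>The shifts by \<open>a\<close> and \<open>- a\<close> already give two solutions,
  distinct because \<open>2 * a\<close> is nonzero and shorter than one period; the line and circle
  count leaves no third.\<close>

lemma line_tangent_pencil_iff_shift:
  assumes k: "\<bar>k\<bar> < 1" and a: "a \<noteq> 0" "\<bar>a\<bar> < ell_K k"
  shows "line_tangent (jacobi_point k u) (jacobi_point k v) (pencil_circle k a) \<longleftrightarrow>
    jacobi_point k v = jacobi_point k (u + a) \<or> jacobi_point k v = jacobi_point k (u - a)"
proof
  show "line_tangent (jacobi_point k u) (jacobi_point k v) (pencil_circle k a)"
    if v: "jacobi_point k v = jacobi_point k (u + a) \<or> jacobi_point k v = jacobi_point k (u - a)"
  proof -
    have ne: "jacobi_point k u \<noteq> jacobi_point k (u + a)" "jacobi_point k u \<noteq> jacobi_point k (u - a)"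
      using jacobi_point_neq[OF k, of u "u + a"] jacobi_point_neq[OF k, of u "u - a"] a by simp_all
    \<comment> \<open>Opposite parameters give the same point set, so the shift by
      \<open>- a\<close> is covered too.\<close>
    have "pencil_circle k (- a) = pencil_circle k a"
      by (simp add: pencil_circle_def pencil_center_def pencil_radius_def cn_minus dn_minus k)
    then show ?thesis
      using v ne a line_tangent_pencil_shift[OF k, of a u v] line_tangent_pencil_shift[OF k, of "- a" u v]
      by auto
  qed
  assume L: "line_tangent (jacobi_point k u) (jacobi_point k v) (pencil_circle k a)"
  have "jacobi_point k u \<noteq> jacobi_point k v" using L by (simp add: line_tangent_def)
  then have "(cn k u * cn k v + dn k a * sn k u * sn k v)\<^sup>2 = (cn k a)\<^sup>2"
    using L line_tangent_pencil_iff[OF k] cn_nonneg[OF k, of a] a by simp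
  then have "cn k u * cn k v + dn k a * sn k u * sn k v = 1 * cn k a \<or>
      cn k u * cn k v + dn k a * sn k u * sn k v = - 1 * cn k a"
    unfolding power2_eq_iff by simp
  \<comment> \<open>The sign lost by squaring is moved onto cn and sn at \<open>v\<close>.\<close>
  then obtain e :: real where e: "e = 1 \<or> e = - 1"
    and "cn k u * cn k v + dn k a * sn k u * sn k v = e * cn k a"
    by blast
  then have 0: "cn k u * (e * cn k v) + (dn k a * sn k u) * (e * sn k v) = cn k a"
    by (auto simp: algebra_simps)
  have 1: "cn k u * cn k (u + a) + (dn k a * sn k u) * sn k (u + a) = cn k a"
    using cn_diff_identity[OF k, of u "u + a"] by (simp add: cn_minus dn_minus k algebra_simps)
  have 2: "cn k u * cn k (u - a) + (dn k a * sn k u) * sn k (u - a) = cn k a"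
    using cn_diff_identity[OF k, of u "u - a"] by (simp add: algebra_simps)
  \<comment> \<open>Doubling the angle squares the point cn + i sn, so a common sign
    \<open>e\<close> disappears.\<close>
  have point_eq: "jacobi_point k x = jacobi_point k y"
    if "e = 1 \<or> e = - 1" "e * cn k x = cn k y" "e * sn k x = sn k y" for e x y
  proof -
    have "jacobi_point k z = Complex (cn k z) (sn k z) ^ 2" for z
      by (simp add: jacobi_point_def cn_def sn_def flip: cis.ctr) (simp add: power2_eq_square cis_mult)
    moreover have "Complex (cn k y) (sn k y) = e * Complex (cn k x) (sn k x)"
      using that by (auto simp: complex_eq_iff)
    ultimately show ?thesis using that by (auto simp: power_mult_distrib)
  qed
  have ne: "cn k (u + a) \<noteq> cn k (u - a) \<or> sn k (u + a) \<noteq> sn k (u - a)"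
  proof (rule ccontr)
    assume "\<not> ?thesis"
    then have "jacobi_point k (u + a) = jacobi_point k (u - a)" by (intro point_eq[of 1]) auto
    then show False
      using jacobi_point_neq[OF k, of "u + a" "u - a"] a by simp
  qed
  have nz: "cn k u \<noteq> 0 \<or> dn k a * sn k u \<noteq> 0"
    using cn_sq[of k u] dn_pos[OF k, of a] by auto
  have circ: "(cn k x)\<^sup>2 + (sn k x)\<^sup>2 = 1" for x
    by (simp add: cn_sq)
  have "(e * cn k v)\<^sup>2 + (e * sn k v)\<^sup>2 = 1"
    using e circ[of v] by (auto simp: power_mult_distrib)
  then have "e * cn k v = cn k (u + a) \<and> e * sn k v = sn k (u + a) \<or>
      e * cn k v = cn k (u - a) \<and> e * sn k v = sn k (u - a)"
    by (rule line_circle_two_points[OF nz _ circ circ 0 1 2 ne])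
  then show "jacobi_point k v = jacobi_point k (u + a) \<or> jacobi_point k v = jacobi_point k (u - a)"
    using point_eq[OF e] by blast
qed

section \<open>Powers and order of a circle map\<close>

lemma psi_pow:
  assumes k: "\<bar>k\<bar> < 1"
  shows "psi k \<alpha> [^]\<^bsub>circle_group k\<^esub> (m::nat) = psi k (am k (real m * ell_g k \<alpha>))"
proof (induction m)
  case 0
  then show ?case by (simp add: circle_group_def BijGroup_def psi_0 k am_0)
next
  case (Suc m)
  then show ?case
    using psi_Bij[OF k] by (simp add: circle_group_def BijGroup_def psi_compose k algebra_simps)
qed

lemma psi_jacobi_point:
  "\<bar>k\<bar> < 1 \<Longrightarrow> psi k (am k b) (jacobi_point k u) = jacobi_point k (u + b)"
  by (simp add: jacobi_point_def psi_cis)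

text \<open>In the elliptic parameter the map is a translation, so it is the identity as soon as it
  fixes the point with parameter 0.\<close>

lemma psi_eq_one_iff:
  assumes k: "\<bar>k\<bar> < 1"
  shows "psi k (am k b) = \<one>\<^bsub>circle_group k\<^esub> \<longleftrightarrow> jacobi_point k b = jacobi_point k 0"
proof
  have one: "\<one>\<^bsub>circle_group k\<^esub> = (\<lambda>z\<in>unit_circle. z)"
    by (simp add: circle_group_def BijGroup_def)
  have circle: "jacobi_point k u \<in> unit_circle" for u by (simp add: jacobi_point_def)
  show "jacobi_point k b = jacobi_point k 0" if "psi k (am k b) = \<one>\<^bsub>circle_group k\<^esub>"
    using psi_jacobi_point[OF k, of b 0] circle[of 0] by (simp add: that one)
  assume b: "jacobi_point k b = jacobi_point k 0"
  show "psi k (am k b) = \<one>\<^bsub>circle_group k\<^esub>"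
    unfolding one
  proof
    fix z show "psi k (am k b) z = (\<lambda>z\<in>unit_circle. z) z"
    proof (cases "z \<in> unit_circle")
      case True
      then obtain u where "z = jacobi_point k u" using unit_circle_jacobi_point[OF k] by blast
      then show ?thesis
        using True b psi_jacobi_point[OF k] jacobi_point_add_cancel[OF k, of u b 0] by simp
    qed (simp add: psi_def)
  qed
qed

text \<open>The divisibility form matches the way the vertices of a polygon repeat;
  \<open>n = 0\<close> stands for infinite order.\<close>

lemma ord_psi_eq_iff:
  assumes k: "\<bar>k\<bar> < 1"
  shows "group.ord (circle_group k) (psi k \<alpha>) = n \<longleftrightarrow>
    (\<forall>m::nat. jacobi_point k (real m * ell_g k \<alpha>) = jacobi_point k 0 \<longleftrightarrow> n dvd m)"
proof -
  interpret comm_group "circle_group k" by (rule comm_group_circle_group[OF k])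
  have "psi k \<alpha> \<in> carrier (circle_group k)"
    using psi_range[OF k] by (simp add: circle_group_def)
  then show ?thesis
    by (simp add: ord_unique psi_pow k psi_eq_one_iff)
qed

section \<open>Interscribed polygons and orbits of a translation\<close>

lemma interscribed_imp_ord:
  fixes m n :: nat
  assumes k: "\<bar>k\<bar> < 1" and n: "3 \<le> n" and a: "a \<noteq> 0" "\<bar>a\<bar> < ell_K k"
    and v: "interscribed n v (pencil_circle k a)"
  shows "jacobi_point k (real m * a) = jacobi_point k 0 \<longleftrightarrow> n dvd m"
proof -
  have inj: "inj_on v {..<n}"
    and tan: "\<And>i. i < n \<Longrightarrow> line_tangent (v i) (v (Suc i mod n)) (pencil_circle k a)"
    and circ: "\<And>i. i < n \<Longrightarrow> v i \<in> unit_circle"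
    using v by (auto simp: interscribed_def)
  \<comment> \<open>The vertices are continued periodically, so that the induction may run past the
    closing side.\<close>
  define w where "w i = v (i mod n)" for i
  have w_eq: "w i = w j \<longleftrightarrow> i mod n = j mod n" for i j
    using inj n by (auto simp: w_def inj_on_eq_iff)
  have w_circ: "w i \<in> unit_circle" for i
    unfolding w_def using circ n by simp
  have w_tan: "line_tangent (w i) (w (Suc i)) (pencil_circle k a)" for i
    using tan[of "i mod n"] n by (simp add: w_def mod_Suc_eq)
  have step: "\<exists>e\<in>{a, - a}. w (Suc i) = jacobi_point k (u + e)" if "w i = jacobi_point k u" for i u
  proof -
    obtain u' where u': "w (Suc i) = jacobi_point k u'"
      using unit_circle_jacobi_point[OF k w_circ] ..
    then show ?thesis
      using w_tan[of i] that line_tangent_pencil_iff_shift[OF k a, of u u'] by auto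
  qed
  obtain u where u: "w 0 = jacobi_point k u"
    using unit_circle_jacobi_point[OF k w_circ] ..
  obtain e where e: "e \<in> {a, - a}" and w1: "w 1 = jacobi_point k (u + e)"
    using step[OF u] unfolding One_nat_def by blast
  \<comment> \<open>Two consecutive vertices are carried along, because the next direction is
    determined by the side just traversed.\<close>
  have "w i = jacobi_point k (u + real i * e) \<and> w (Suc i) = jacobi_point k (u + real (Suc i) * e)" for i
  proof (induction i)
    case 0
    then show ?case using u w1 by simp
  next
    case (Suc i)
    obtain e' where e': "e' \<in> {a, - a}" "w (Suc (Suc i)) = jacobi_point k (u + real (Suc i) * e + e')"
      using step Suc by blast
    \<comment> \<open>Returning after two sides would force \<open>n\<close> to divide 2.\<close>
    have "w (Suc (Suc i)) \<noteq> w i"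
    proof
      assume "w (Suc (Suc i)) = w i"
      then have "n dvd Suc (Suc i) - i" by (simp only: w_eq mod_eq_dvd_iff_nat)
      then show False using n by (auto dest: dvd_imp_le)
    qed
    then have "e' \<noteq> - e" using Suc e' by (auto simp: algebra_simps)
    then have "e' = e" using e e' by auto
    then show ?case using Suc e' by (simp add: algebra_simps)
  qed
  then have "jacobi_point k (u + real m * e) = jacobi_point k (u + 0) \<longleftrightarrow> n dvd m"
    using w_eq[of m 0] u by (metis add.right_neutral dvd_eq_mod_eq_0 mod_0)
  then have *: "jacobi_point k (real m * e) = jacobi_point k 0 \<longleftrightarrow> n dvd m"
    by (simp only: jacobi_point_add_cancel[OF k])
  \<comment> \<open>Translating by \<open>x\<close> exchanges the two conditions, so the direction
    of travel does not affect the order.\<close>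
  have minus: "jacobi_point k (- x) = jacobi_point k 0 \<longleftrightarrow> jacobi_point k x = jacobi_point k 0" for x
    using jacobi_point_add_cancel[OF k, of x "- x" 0]
    unfolding add.right_inverse add_0_right by metis
  from e have "e = a \<or> e = - a" by simp
  then show ?thesis
  proof
    assume "e = a"
    then show ?thesis using * by simp
  next
    assume "e = - a"
    then show ?thesis using * minus[of "real m * a"] by simp
  qed
qed

text \<open>The polygon is the orbit of parameter 0 under translation by \<open>a\<close>. Its
  vertices are distinct because a positive index difference below \<open>n\<close> is not divisible
  by \<open>n\<close>.\<close>

lemma interscribed_orbit:
  fixes n :: nat and a :: real
  assumes k: "\<bar>k\<bar> < 1" and n: "0 < n" and a: "a \<noteq> 0" "\<bar>a\<bar> < ell_K k"
    and ord: "\<And>m::nat. jacobi_point k (real m * a) = jacobi_point k 0 \<longleftrightarrow> n dvd m"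
  shows "interscribed n (\<lambda>i. jacobi_point k (real i * a)) (pencil_circle k a)"
proof -
  have eq: "jacobi_point k (real i * a) = jacobi_point k (real j * a) \<longleftrightarrow> n dvd j - i" if "i \<le> j" for i j :: nat
  proof -
    have "real j * a = real i * a + real (j - i) * a" using that by (simp add: of_nat_diff algebra_simps)
    then have "jacobi_point k (real j * a) = jacobi_point k (real i * a + 0) \<longleftrightarrow> n dvd j - i"
      by (simp only: jacobi_point_add_cancel[OF k] ord)
    then show ?thesis by (simp add: eq_commute[of "jacobi_point k (real i * a)"])
  qed
  have "inj_on (\<lambda>i. jacobi_point k (real i * a)) {..<n}"
    by (rule linorder_inj_onI) (auto simp: eq dest: dvd_imp_le)
  moreover have "line_tangent (jacobi_point k (real i * a)) (jacobi_point k (real (Suc i mod n) * a))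
      (pencil_circle k a)" for i :: nat
  proof -
    \<comment> \<open>Reducing the index modulo \<open>n\<close> keeps the point, so the closing
      side is also a shift by \<open>a\<close>.\<close>
    have "jacobi_point k (real (Suc i mod n) * a) = jacobi_point k (real (Suc i) * a)"
      by (subst eq) (auto intro: dvd_minus_mod)
    then show ?thesis
      unfolding line_tangent_pencil_iff_shift[OF k a] by (simp add: algebra_simps)
  qed
  ultimately show ?thesis by (auto simp: interscribed_def jacobi_point_def)
qed

theorem corollary8:
  fixes k a \<alpha> :: real and n :: nat and C\<^sub>1 :: "complex set"
  assumes "0 < k" "k < 1" and "n \<ge> 3"
    and "a \<in> {- ell_K k<..ell_K k}" and "C\<^sub>1 = pencil_circle k a"
    and "0 < pencil_radius k a" and "C\<^sub>1 \<subseteq> ball 0 1"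
    and "a = ell_g k \<alpha>"
  shows "((\<exists>v. interscribed n v C\<^sub>1) \<longleftrightarrow> group.ord (circle_group k) (psi k \<alpha>) = n) \<and>
    (\<forall>v. interscribed n v C\<^sub>1 \<longrightarrow>
      (\<forall>i<n. \<forall>j<n. i \<noteq> j \<and> \<not> consecutive n i j \<longrightarrow>
        (\<exists>D\<in>pencil k. line_tangent (v i) (v j) D)))"
proof (intro conjI allI impI)
  have k: "\<bar>k\<bar> < 1" using assms by simp
  \<comment> \<open>The two degenerate parameters are excluded first: 0 gives the unit circle, which
    is not inside the open disc, and K gives radius 0.\<close>
  have "a \<noteq> 0"
  proof
    assume "a = 0"
    then have "unit_circle \<subseteq> ball 0 1" using assms pencil_circle_0[OF k] by simp
    then have "(1::complex) \<in> ball 0 1" by (rule subsetD) simp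
    then show False by simp
  qed
  moreover have "a \<noteq> ell_K k"
  proof
    assume "a = ell_K k"
    then have "am k a = pi / 2" unfolding ell_K_def using am_ell_g[OF k] by metis
    then have "cn k a = 0" unfolding cn_def by (metis cos_pi_half)
    then show False using assms(6) by (simp add: pencil_radius_def)
  qed
  ultimately have a: "a \<noteq> 0" "\<bar>a\<bar> < ell_K k" using assms(4) by auto
  show "(\<exists>v. interscribed n v C\<^sub>1) \<longleftrightarrow> group.ord (circle_group k) (psi k \<alpha>) = n"
    unfolding ord_psi_eq_iff[OF k] \<open>a = ell_g k \<alpha>\<close>[symmetric] \<open>C\<^sub>1 = pencil_circle k a\<close>
    using interscribed_imp_ord[OF k assms(3) a] interscribed_orbit[OF k _ a, of n] assms(3) by auto
  fix v i j
  assume "interscribed n v C\<^sub>1" and ij: "i < n" "j < n" "i \<noteq> j \<and> \<not> consecutive n i j"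
  then have v: "inj_on v {..<n}" "v ` {..<n} \<subseteq> unit_circle" by (simp_all add: interscribed_def)
  \<comment> \<open>The endpoints of the diagonal are distinct points of the unit circle, and any
    such chord touches a pencil circle.\<close>
  then have "v i \<noteq> v j" using ij by (auto dest: inj_onD)
  then show "\<exists>D\<in>pencil k. line_tangent (v i) (v j) D"
    using v ij by (intro chord_tangent_pencil k) auto
qed

end
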